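(* Let $m \geq 1$ be an integer and let the edges of the complete graph $K_{2m}$ be properly colored with $2m-1$ colors. Then $K_{2m}$ contains at least $\left\lfloor \frac{\sqrt{6m+9}}{3} \right\rfloor$ pairwise edge-disjoint rainbow spanning trees.
   Context: A proper edge-coloring of a graph assigns colors to edges so that any two edges sharing a vertex receive distinct colors. A subgraph of an edge-colored graph is rainbow if all of its edges receive distinct colors. A spanning tree of $K_{2m}$ is an acyclic connected subgraph containing all $2m$ vertices. *)

theory Defs
  imports Complex_Main
begin

text \<open>Undirected simple graphs are given by a vertex set \<open>V\<close> and a set of two-element
  subsets of \<open>V\<close>.\<close>

definition complete_edges :: "'a set \<Rightarrow> 'a set set" where
  "complete_edges V = {{u, v} | u v. u \<in> V \<and> v \<in> V \<and> u \<noteq> v}"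

definition proper_edge_coloring :: "'a set set \<Rightarrow> 'c set \<Rightarrow> ('a set \<Rightarrow> 'c) \<Rightarrow> bool" where
  "proper_edge_coloring E C c \<longleftrightarrow>
     c ` E \<subseteq> C \<and> (\<forall>e\<in>E. \<forall>f\<in>E. e \<noteq> f \<and> e \<inter> f \<noteq> {} \<longrightarrow> c e \<noteq> c f)"

definition rainbow :: "('a set \<Rightarrow> 'c) \<Rightarrow> 'a set set \<Rightarrow> bool" where
  "rainbow c T \<longleftrightarrow> inj_on c T"

definition walk_in :: "'a set set \<Rightarrow> 'a list \<Rightarrow> bool" where
  "walk_in T p \<longleftrightarrow> p \<noteq> [] \<and> successively (\<lambda>x y. {x, y} \<in> T) p"

definition connected_graph :: "'a set \<Rightarrow> 'a set set \<Rightarrow> bool" where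
  "connected_graph V T \<longleftrightarrow>
     V \<noteq> {} \<and> (\<forall>u\<in>V. \<forall>v\<in>V. \<exists>p. walk_in T p \<and> set p \<subseteq> V \<and> hd p = u \<and> last p = v)"

text \<open>A cycle is listed without repeating its first vertex at the end.\<close>

definition cycle_in :: "'a set set \<Rightarrow> 'a list \<Rightarrow> bool" where
  "cycle_in T p \<longleftrightarrow> 3 \<le> length p \<and> distinct p \<and> walk_in T p \<and> {last p, hd p} \<in> T"

definition acyclic_graph :: "'a set set \<Rightarrow> bool" where
  "acyclic_graph T \<longleftrightarrow> (\<nexists>p. cycle_in T p)"

text \<open>A spanning subgraph has the same vertex set \<open>V\<close> as the ambient graph, so it is
  identified with its edge set \<open>T\<close>.\<close>

definition spanning_tree :: "'a set \<Rightarrow> 'a set set \<Rightarrow> 'a set set \<Rightarrow> bool" where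
  "spanning_tree V E T \<longleftrightarrow> T \<subseteq> E \<and> connected_graph V T \<and> acyclic_graph T"

end

theory Submission
  imports Defs
begin

text \<open>
  Every vertex sees every colour exactly once, so every star is a rainbow spanning tree. Take
  \<open>k = 2 * h + 1\<close> stars with centres \<open>x i\<close> for \<open>i < k\<close>; the stars at \<open>x i\<close> and \<open>x j\<close> share only the
  edge \<open>{x i, x j}\<close>. For each cyclic distance \<open>d\<close> pick one further colour \<open>b d\<close>, and let \<open>u i d\<close> be the
  \<open>b d\<close>-neighbour of \<open>x i\<close>. With \<open>j = i + d\<close> modulo \<open>k\<close>, the \<open>i\<close>-th tree gives up \<open>{x i, x j}\<close> and
  \<open>{x i, u i d}\<close>; it reattaches \<open>x j\<close> by \<open>{x j, u j d}\<close>, of the lost colour \<open>b d\<close>, which the \<open>j\<close>-th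
  tree gave up, and it reattaches \<open>u i d\<close> by its edge \<open>{u i d, z i d}\<close> in the colour of \<open>{x i, x j}\<close>.

  The centres are chosen greedily so that for fixed \<open>d\<close> the edges \<open>{x i, x (i + d)}\<close> have distinct
  colours. The colours \<open>b d\<close> are then chosen greedily; at most \<open>12 * h\<^sup>2 - h - 5\<close> colours are
  forbidden at each step, and \<open>card V \<ge> 12 * h\<^sup>2 - 3\<close> leaves a free one.
\<close>

section \<open>Greedy choice\<close>

text \<open>\<open>cong\<close> says that \<open>P d\<close> looks at \<open>f\<close> only below
  \<open>d\<close>, so overriding \<open>f\<close> at a new index keeps all earlier conditions. It
  serves twice, for the centres and for the colours.\<close>

lemma greedy_choice:
  fixes P :: "nat \<Rightarrow> (nat \<Rightarrow> 'b) \<Rightarrow> 'b \<Rightarrow> bool"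
  assumes cong: "\<And>d f g y. (\<And>e. e < d \<Longrightarrow> f e = g e) \<Longrightarrow> P d f y \<Longrightarrow> P d g y"
    and ex: "\<And>d f. d < h \<Longrightarrow> (\<And>e. e < d \<Longrightarrow> P e f (f e)) \<Longrightarrow> \<exists>y. P d f y"
  shows "\<exists>f. \<forall>d<h. P d f (f d)"
proof -
  have "\<exists>f. \<forall>d<t. P d f (f d)" if "t \<le> h" for t
    using that
  proof (induction t)
    case (Suc t)
    then obtain f where f: "\<forall>d<t. P d f (f d)" by auto
    then obtain y where y: "P t f y" using ex[of t f] Suc.prems by auto
    have "P d (f(t := y)) ((f(t := y)) d)" if "d < Suc t" for d
    proof (cases "d = t")
      case True
      then show ?thesis using cong[of t f "f(t := y)" y] y by simp
    next
      case False
      then have "d < t" using that by simp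
      then show ?thesis using cong[of d f "f(t := y)" "f d"] f by auto
    qed
    then show ?case by blast
  qed simp
  then show ?thesis by blast
qed

lemma ex_notin_small:
  assumes "card F < card A" "finite F"
  shows "\<exists>y\<in>A. y \<notin> F"
  using assms by (metis card_mono linorder_not_le subsetI)

section \<open>Walks and trees given by parent functions\<close>

lemma walk_rev: "walk_in T p \<Longrightarrow> walk_in T (rev p)"
  unfolding walk_in_def by (simp add: insert_commute)

lemma walk_join:
  assumes "walk_in T p" "walk_in T q" "last p = hd q"
  obtains r where "walk_in T r" "set r \<subseteq> set p \<union> set q" "hd r = hd p" "last r = last q"
proof
  show "walk_in T (p @ tl q)"
    using assms by (cases q) (auto simp: walk_in_def successively_append_iff successively_Cons)
  show "set (p @ tl q) \<subseteq> set p \<union> set q"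
    by (cases q) auto
  show "hd (p @ tl q) = hd p"
    using assms by (auto simp: walk_in_def)
  show "last (p @ tl q) = last q"
    using assms by (cases q) (auto simp: walk_in_def)
qed

text \<open>Following \<open>par\<close> lowers \<open>rank\<close>, so every vertex reaches
  \<open>rt\<close>; walks to \<open>rt\<close> compose to connect any two vertices. A cycle fails
  at its vertex of maximal rank.\<close>

lemma spanning_tree_of_parents:
  fixes rank :: "'a \<Rightarrow> nat"
  assumes rt: "rt \<in> V"
    and par: "\<And>v. v \<in> V - {rt} \<Longrightarrow> par v \<in> V"
    and rank: "\<And>v. v \<in> V - {rt} \<Longrightarrow> rank (par v) < rank v"
  shows "spanning_tree V (complete_edges V) ((\<lambda>v. {v, par v}) ` (V - {rt}))"
proof -
  define T where "T = (\<lambda>v. {v, par v}) ` (V - {rt})"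
  have to_root: "\<exists>p. walk_in T p \<and> set p \<subseteq> V \<and> hd p = v \<and> last p = rt" if "v \<in> V" for v
    using that
  proof (induction "rank v" arbitrary: v rule: less_induct)
    case less
    show ?case
    proof (cases "v = rt")
      case True
      then show ?thesis using rt by (intro exI[of _ "[rt]"]) (simp add: walk_in_def)
    next
      case False
      then have v: "v \<in> V - {rt}" using less.prems by simp
      from less.hyps[OF rank[OF v] par[OF v]] obtain p
        where p: "walk_in T p" "set p \<subseteq> V" "hd p = par v" "last p = rt" by blast
      have "{v, par v} \<in> T" using v by (auto simp: T_def)
      then have "walk_in T (v # p)"
        using p by (auto simp: walk_in_def successively_Cons)
      then show ?thesis using p v by (intro exI[of _ "v # p"]) (auto simp: walk_in_def)
    qed
  qed
  have "connected_graph V T"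
    unfolding connected_graph_def
  proof (intro conjI ballI)
    fix u v assume "u \<in> V" "v \<in> V"
    then obtain p q where
      p: "walk_in T p" "set p \<subseteq> V" "hd p = u" "last p = rt" and
      q: "walk_in T q" "set q \<subseteq> V" "hd q = v" "last q = rt"
      using to_root by metis
    have "last p = hd (rev q)" using p q by (simp add: hd_rev)
    from walk_join[OF p(1) walk_rev[OF q(1)] this]
    obtain r where "walk_in T r" "set r \<subseteq> set p \<union> set (rev q)" "hd r = hd p" "last r = last (rev q)" .
    then show "\<exists>p. walk_in T p \<and> set p \<subseteq> V \<and> hd p = u \<and> last p = v"
      using p q by (intro exI[of _ r]) (auto simp: last_rev)
  qed (use rt in auto)
  moreover have "acyclic_graph T"
    unfolding acyclic_graph_def
  proof
    assume "\<exists>p. cycle_in T p"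
    then obtain p where p: "3 \<le> length p" "distinct p" "walk_in T p" "{last p, hd p} \<in> T"
      by (auto simp: cycle_in_def)
    let ?n = "length p"
    have edge: "{p ! i, p ! (Suc i mod ?n)} \<in> T" if "i < ?n" for i
    proof (cases "Suc i < ?n")
      case True
      then show ?thesis using p(3) by (auto simp: walk_in_def successively_conv_nth)
    next
      case False
      then have "Suc i = ?n" using that by simp
      then show ?thesis using p(1,4)
        by (metis diff_Suc_1 hd_conv_nth last_conv_nth list.size(3) mod_self not_numeral_le_zero)
    qed
    have "\<exists>i<?n. \<forall>j<?n. rank (p ! j) \<le> rank (p ! i)"
    proof -
      let ?R = "(\<lambda>i. rank (p ! i)) ` {..<?n}"
      have "finite ?R" "?R \<noteq> {}" using p(1) by (auto simp: lessThan_empty_iff)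
      from Max_in[OF this] Max_ge[OF this(1)] show ?thesis by force
    qed
    then obtain i where i: "i < ?n" and max: "\<And>j. j < ?n \<Longrightarrow> rank (p ! j) \<le> rank (p ! i)"
      by blast
    \<comment> \<open>Both neighbours on the cycle of a vertex of maximal rank are its parent.\<close>
    have nbr: "p ! j = par (p ! i)" if j: "j < ?n" "{p ! i, p ! j} \<in> T" for j
    proof -
      obtain v where v: "v \<in> V - {rt}" "{p ! i, p ! j} = {v, par v}"
        using j(2) by (auto simp: T_def)
      then show ?thesis using rank[OF v(1)] max[OF j(1)] by (auto simp: doubleton_eq_iff)
    qed
    define next_i where "next_i = Suc i mod ?n"
    define prev_i where "prev_i = (if i = 0 then ?n - 1 else i - 1)"
    \<comment> \<open>Length at least 3 separates the two cyclic neighbours of position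
      \<open>i\<close>, so both being the parent contradicts \<open>distinct p\<close>.\<close>
    have "next_i < ?n" "prev_i < ?n" "next_i \<noteq> prev_i" "Suc prev_i mod ?n = i"
      using p(1) i by (auto simp: next_i_def prev_i_def mod_Suc)
    moreover have "p ! next_i = par (p ! i)"
      using nbr edge[OF i] \<open>next_i < ?n\<close> by (simp add: next_i_def)
    moreover have "p ! prev_i = par (p ! i)"
      using nbr edge[of prev_i] calculation by (simp add: insert_commute)
    ultimately show False using p(2) by (metis nth_eq_iff_index_eq)
  qed
  moreover have "T \<subseteq> complete_edges V"
    using par rank by (fastforce simp: T_def complete_edges_def)
  ultimately show ?thesis by (simp add: spanning_tree_def T_def)
qed

section \<open>Colour classes as perfect matchings\<close>

locale one_factorization =
  fixes V :: "'a set" and C :: "'c set" and c :: "'a set \<Rightarrow> 'c"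
  assumes finite_V: "finite V" and V_nonempty: "V \<noteq> {}"
    and finite_C: "finite C" and card_C: "card C = card V - 1"
    and proper: "proper_edge_coloring (complete_edges V) C c"
begin

lemma edge_complete: "v \<in> V \<Longrightarrow> w \<in> V \<Longrightarrow> v \<noteq> w \<Longrightarrow> {v, w} \<in> complete_edges V"
  by (auto simp: complete_edges_def)

lemma color_in: "v \<in> V \<Longrightarrow> w \<in> V \<Longrightarrow> v \<noteq> w \<Longrightarrow> c {v, w} \<in> C"
  using proper edge_complete by (auto simp: proper_edge_coloring_def)

lemma color_proper:
  assumes "e \<in> complete_edges V" "f \<in> complete_edges V" "e \<inter> f \<noteq> {}" "c e = c f"
  shows "e = f"
  using proper assms by (auto simp: proper_edge_coloring_def)

lemma color_inj:
  assumes "v \<in> V" "w \<in> V" "w' \<in> V" "w \<noteq> v" "w' \<noteq> v" "c {v, w} = c {v, w'}"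
  shows "w = w'"
  using color_proper[of "{v, w}" "{v, w'}"] assms edge_complete
  by (auto simp: doubleton_eq_iff)

text \<open>The \<open>card V - 1\<close> edges at \<open>v\<close> have distinct colours, and
  \<open>C\<close> has no more colours than that, so each one occurs.\<close>

lemma ex1_neighbour:
  assumes "v \<in> V" "b \<in> C"
  shows "\<exists>!w. w \<in> V \<and> w \<noteq> v \<and> c {v, w} = b"
proof -
  have inj: "inj_on (\<lambda>w. c {v, w}) (V - {v})"
    by (rule inj_onI) (use color_inj assms in auto)
  have "(\<lambda>w. c {v, w}) ` (V - {v}) = C"
  proof (rule card_subset_eq)
    show "(\<lambda>w. c {v, w}) ` (V - {v}) \<subseteq> C" using color_in assms by auto
    show "card ((\<lambda>w. c {v, w}) ` (V - {v})) = card C"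
      using card_image[OF inj] assms finite_V card_C by simp
  qed (rule finite_C)
  then have "b \<in> (\<lambda>w. c {v, w}) ` (V - {v})" using assms by simp
  then show ?thesis using color_inj assms by blast
qed

text \<open>The matching of colour \<open>b\<close> as an involution of \<open>V\<close>.\<close>

definition nb :: "'c \<Rightarrow> 'a \<Rightarrow> 'a" where
  "nb b v = (THE w. w \<in> V \<and> w \<noteq> v \<and> c {v, w} = b)"

lemma nb:
  assumes "v \<in> V" "b \<in> C"
  shows "nb b v \<in> V" "nb b v \<noteq> v" "c {v, nb b v} = b"
  using theI'[OF ex1_neighbour[OF assms]] by (auto simp: nb_def)

lemma nb_eqI:
  assumes "v \<in> V" "w \<in> V" "w \<noteq> v" "c {v, w} = b"
  shows "nb b v = w"
  using nb[of v b] color_inj[of v w "nb b v"] color_in[of v w] assms by auto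

lemma nb_nb:
  assumes "v \<in> V" "b \<in> C"
  shows "nb b (nb b v) = v"
  using nb[OF assms] assms by (intro nb_eqI) (auto simp: insert_commute)

end

section \<open>Rotational tournament on the indices\<close>

locale rooted_one_factorization = one_factorization V C c
  for V :: "'a set" and C :: "'c set" and c :: "'a set \<Rightarrow> 'c" +
  fixes h :: nat
  assumes large: "12 * h * h \<le> card V + 3"
begin

abbreviation "k \<equiv> Suc (2 * h)"

text \<open>The rotational tournament on \<open>{..<k}\<close>: since \<open>k\<close> is odd, each pair of indices is
  joined by \<open>step d\<close> for a single \<open>d < h\<close>, in one direction.\<close>

definition step :: "nat \<Rightarrow> nat \<Rightarrow> nat" where
  "step d i = (i + d + 1) mod k"

lemma step_less: "step d i < k"
  by (simp add: step_def)

text \<open>Either no wrap-around, or exactly one that lands below \<open>i\<close>. This turns the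
  facts about \<open>step\<close> into linear arithmetic.\<close>

lemma step_cases:
  assumes "i < k" "d < h"
  shows "step d i = i + d + 1 \<and> i + d + 1 < k \<or> k + step d i = i + d + 1 \<and> step d i < i"
proof (cases "i + d + 1 < k")
  case False
  then have "step d i = i + d + 1 - k"
    using assms by (simp add: step_def le_mod_geq)
  then show ?thesis using False assms by auto
qed (simp add: step_def)

lemma step_neq: "i < k \<Longrightarrow> d < h \<Longrightarrow> step d i \<noteq> i"
  using step_cases[of i d] by linarith

lemma step_inj: "i < k \<Longrightarrow> j < k \<Longrightarrow> d < h \<Longrightarrow> step d i = step d j \<Longrightarrow> i = j"
  using step_cases[of i d] step_cases[of j d] by linarith

lemma step_inj_distance: "i < k \<Longrightarrow> d < h \<Longrightarrow> e < h \<Longrightarrow> step d i = step e i \<Longrightarrow> d = e"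
  using step_cases[of i d] step_cases[of i e] by linarith

lemma step_step_neq:
  assumes "i < k" "d < h"
  shows "step d (step d i) \<noteq> i"
proof
  assume "step d (step d i) = i"
  \<comment> \<open>Two advances by \<open>d + 1\<close> that return to \<open>i\<close> must add up
    to exactly \<open>k\<close>, which is odd.\<close>
  then have "2 * h + 1 = 2 * (d + 1)"
    using assms step_cases[of i d] step_cases[of "step d i" d] step_less[of d i] by arith
  then show False by presburger
qed

text \<open>One of the two arcs of the index circle between \<open>i\<close> and \<open>j\<close>
  has length at most \<open>h\<close>. The witnesses subtract 1 because \<open>step d\<close>
  advances by \<open>d + 1\<close>.\<close>

lemma step_total_less:
  assumes "i < j" "j < k"
  obtains d where "d < h" "j = step d i \<or> i = step d j"
proof (cases "j - i \<le> h")
  case True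
  then show ?thesis using assms that[of "j - i - 1"] by (auto simp: step_def)
next
  case False
  have "j + (k - (j - i) - 1) + 1 = i + k" using assms by auto
  then have "step (k - (j - i) - 1) j = i"
    unfolding step_def using assms by (simp only: mod_add_self2) simp
  then show ?thesis using False assms that[of "k - (j - i) - 1"] by auto
qed

lemma step_total:
  assumes "i < k" "j < k" "i \<noteq> j"
  obtains d where "d < h" "j = step d i \<or> i = step d j"
proof (cases i j rule: linorder_cases)
  case less
  then show ?thesis using step_total_less[OF less assms(2)] that by blast
next
  case greater
  then show ?thesis using step_total_less[OF greater assms(1)] that by blast
qed (use assms in simp)

section \<open>Choice of the centres\<close>

definition dist_class :: "nat \<Rightarrow> nat \<Rightarrow> nat" where
  "dist_class l j = (if j - l \<le> h then j - l - 1 else k - (j - l) - 1)"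

lemma dist_class_eq:
  assumes "l < j" "j < k" "d < h" "j = step d l \<or> l = step d j"
  shows "dist_class l j = d"
  using assms step_cases[of l d] step_cases[of j d] unfolding dist_class_def by auto

definition arc_color :: "(nat \<Rightarrow> 'a) \<Rightarrow> nat \<Rightarrow> nat \<Rightarrow> 'c" where
  "arc_color x i d = c {x i, x (step d i)}"

text \<open>Arcs of one class that share a vertex differ in colour by properness. Disjoint ones have
  different greatest indices, and the centre at the greater of these was chosen to avoid the colour
  of the other arc.\<close>

lemma ex_roots:
  obtains x where "inj_on x {..<k}" "x ` {..<k} \<subseteq> V"
    "\<And>i j d. i < k \<Longrightarrow> j < k \<Longrightarrow> d < h \<Longrightarrow> arc_color x i d = arc_color x j d \<Longrightarrow> i = j"
proof -
  \<comment> \<open>A pair \<open>(l, p)\<close> in \<open>I j\<close> stands for the new edge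
    \<open>{x l, x j}\<close> and an arc of the same class, starting at \<open>p\<close>, with both
    ends before \<open>j\<close>. \<open>F j x\<close> collects the earlier centres and the vertices
    that would repeat that arc's colour.\<close>
  define I where "I j = {(l, p). l < j \<and> p < j \<and> step (dist_class l j) p < j}" for j
  define F where "F j x = x ` {..<j} \<union>
    (\<lambda>(l, p). nb (arc_color x p (dist_class l j)) (x l)) ` I j" for j and x :: "nat \<Rightarrow> 'a"
  have "\<exists>x. \<forall>j<k. x j \<in> V \<and> x j \<notin> F j x"
  proof (rule greedy_choice[where P = "\<lambda>j x y. y \<in> V \<and> y \<notin> F j x"])
    fix j and x x' :: "nat \<Rightarrow> 'a" and y
    assume eq: "\<And>e. e < j \<Longrightarrow> x e = x' e" and y: "y \<in> V \<and> y \<notin> F j x"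
    have "F j x = F j x'"
      unfolding F_def by (intro arg_cong2[of _ _ _ _ "(\<union>)"] image_cong)
        (auto simp: eq I_def arc_color_def)
    then show "y \<in> V \<and> y \<notin> F j x'" using y by simp
  next
    fix j and x :: "nat \<Rightarrow> 'a" assume j: "j < k"
    have I: "I j \<subseteq> {..<j} \<times> {..<j}" by (auto simp: I_def)
    then have finI: "finite (I j)" by (rule finite_subset) auto
    have "card (I j) \<le> j * j" using card_mono[OF _ I] by simp
    have "card (F j x) \<le> card (x ` {..<j}) + card ((\<lambda>(l, p). nb (arc_color x p (dist_class l j)) (x l)) ` I j)"
      unfolding F_def by (rule card_Un_le)
    also have "\<dots> \<le> j + j * j"
      using card_image_le[of "{..<j}" x] card_image_le[OF finI] \<open>card (I j) \<le> j * j\<close>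
      by (intro add_mono) (auto intro: order_trans)
    also have "\<dots> \<le> 2 * h + (2 * h) * (2 * h)"
      using j by (intro add_mono mult_mono) auto
    \<comment> \<open>For \<open>h >= 1\<close> the left side is at most \<open>6 * h * h\<close>,
      below \<open>12 * h * h - 3\<close>. For \<open>h = 0\<close> it is 0 and \<open>V\<close> is
      nonempty.\<close>
    also have "\<dots> < card V"
    proof (cases "h = 0")
      case True
      then show ?thesis using finite_V V_nonempty by (simp add: card_gt_0_iff)
    next
      case False
      then have "h \<le> h * h" "1 \<le> h * h" by auto
      moreover have "12 * (h * h) \<le> card V + 3" "2 * h * (2 * h) = 4 * (h * h)"
        using large by auto
      ultimately show ?thesis by linarith
    qed
    finally have "card (F j x) < card V" .
    moreover have "finite (F j x)" using finI by (simp add: F_def)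
    ultimately show "\<exists>y. y \<in> V \<and> y \<notin> F j x"
      using ex_notin_small by blast
  qed
  then obtain x where x: "\<And>j. j < k \<Longrightarrow> x j \<in> V" "\<And>j. j < k \<Longrightarrow> x j \<notin> F j x" by blast
  have neq: "x i \<noteq> x j" if "i < j" "j < k" for i j
  proof -
    have "x j \<notin> x ` {..<j}" using x(2)[OF that(2)] by (simp add: F_def)
    moreover have "x i \<in> x ` {..<j}" using that by simp
    ultimately show ?thesis by metis
  qed
  have inj: "inj_on x {..<k}"
  proof (rule inj_onI)
    fix i j assume "i \<in> {..<k}" "j \<in> {..<k}" "x i = x j"
    then show "i = j" using neq[of i j] neq[of j i] by (cases i j rule: linorder_cases) auto
  qed
  have last_root: "c {x l, x j} \<noteq> arc_color x p d"
    if "l < j" "j < k" "d < h" "j = step d l \<or> l = step d j" "p < j" "step d p < j" for l j p d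
  proof
    assume "c {x l, x j} = arc_color x p d"
    then have "nb (arc_color x p d) (x l) = x j"
      using x(1) neq[of l j] that by (intro nb_eqI) auto
    moreover have "(l, p) \<in> I j" "dist_class l j = d"
      using that dist_class_eq[of l j d] by (auto simp: I_def)
    ultimately have "x j \<in> F j x" unfolding F_def by force
    then show False using x(2) that by blast
  qed
  \<comment> \<open>The greatest index may be the head or the tail of its arc;
    \<open>last_root\<close> covers both orientations.\<close>
  have contra: False
    if "i < k" "j < k" "d < h" and eq: "arc_color x i d = arc_color x j d"
      and disj: "{i, step d i} \<inter> {j, step d j} = {}"
      and max: "max j (step d j) < max i (step d i)" for i j d
  proof (cases "i < step d i")
    case True
    then show False
      using last_root[of i "step d i" d j] that step_less[of d i] by (simp add: arc_color_def)
  next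
    case False
    then have "step d i < i" using step_neq that by (metis linorder_neqE_nat)
    then show False
      using last_root[of "step d i" i d j] that by (simp add: arc_color_def insert_commute)
  qed
  have "i = j" if ij: "i < k" "j < k" "d < h" and eq: "arc_color x i d = arc_color x j d" for i j d
  proof (rule ccontr)
    assume "i \<noteq> j"
    have lt: "step d i < k" "step d j < k" by (rule step_less)+
    have ne: "step d i \<noteq> i" "step d j \<noteq> j" using step_neq ij by auto
    have "{i, step d i} \<noteq> {j, step d j}"
      using \<open>i \<noteq> j\<close> step_step_neq[of i d] ij by (auto simp: doubleton_eq_iff)
    then have "x ` {i, step d i} \<noteq> x ` {j, step d j}"
      using inj_on_image_eq_iff[OF inj, of "{i, step d i}" "{j, step d j}"] ij lt by simp
    moreover have "x ` {i, step d i} \<in> complete_edges V" "x ` {j, step d j} \<in> complete_edges V"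
      using ij lt ne x(1) inj by (auto intro!: edge_complete simp: inj_on_eq_iff)
    moreover have "c (x ` {i, step d i}) = c (x ` {j, step d j})"
      using eq by (simp add: arc_color_def)
    ultimately have "x ` {i, step d i} \<inter> x ` {j, step d j} = {}"
      using color_proper by blast
    then have disj: "{i, step d i} \<inter> {j, step d j} = {}" by auto
    then have "max j (step d j) \<noteq> max i (step d i)" by (auto simp: max_def)
    then show False
      using contra[of i j d] contra[of j i d] ij eq disj by (metis inf_commute linorder_neqE_nat)
  qed
  then show thesis using that[of x] inj x(1) by blast
qed

end

section \<open>Choice of the colours \<open>b d\<close>\<close>

locale rainbow_roots = rooted_one_factorization V C c h
  for V :: "'a set" and C :: "'c set" and c :: "'a set \<Rightarrow> 'c" and h :: nat +
  fixes x :: "nat \<Rightarrow> 'a"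
  assumes roots_inj: "inj_on x {..<k}"
    and roots_V: "x ` {..<k} \<subseteq> V"
    and class_rainbow: "\<lbrakk>i < k; j < k; d < h; arc_color x i d = arc_color x j d\<rbrakk> \<Longrightarrow> i = j"
begin

abbreviation "a \<equiv> arc_color x"

lemma root_in: "i < k \<Longrightarrow> x i \<in> V"
  using roots_V by auto

lemma root_eq_iff: "i < k \<Longrightarrow> j < k \<Longrightarrow> x i = x j \<longleftrightarrow> i = j"
  using roots_inj by (simp add: inj_on_eq_iff)

lemma root_step_neq: "i < k \<Longrightarrow> d < h \<Longrightarrow> x (step d i) \<noteq> x i"
  using root_eq_iff[OF step_less[of d i], of i] step_neq[of i d] by blast

lemma a_in: "i < k \<Longrightarrow> d < h \<Longrightarrow> a i d \<in> C"
  unfolding arc_color_def by (metis color_in root_in root_step_neq step_less)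

lemma nb_a: "i < k \<Longrightarrow> d < h \<Longrightarrow> nb (a i d) (x i) = x (step d i)"
  using root_in[of i] root_in[OF step_less] root_step_neq[of i d]
  by (intro nb_eqI) (auto simp: arc_color_def)

lemma nb_a': "i < k \<Longrightarrow> d < h \<Longrightarrow> nb (a i d) (x (step d i)) = x i"
  using root_in[of i] root_in[OF step_less] root_step_neq[of i d]
  by (intro nb_eqI) (auto simp: arc_color_def insert_commute)

lemma root_pair_color:
  assumes "i < k" "j < k" "i \<noteq> j"
  shows "c {x i, x j} \<in> (\<lambda>(i, d). a i d) ` ({..<k} \<times> {..<h})"
proof -
  obtain d where d: "d < h" "j = step d i \<or> i = step d j" using step_total assms by blast
  then have "c {x i, x j} = a i d \<or> c {x i, x j} = a j d"
    by (auto simp: arc_color_def insert_commute)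
  then show ?thesis using assms d by force
qed

text \<open>With \<open>u i = nb (b d) (x i)\<close> and \<open>z i = nb (a i d) (u i)\<close>, avoiding the five sets keeps, in this
  order: \<open>u i\<close> off the roots; \<open>z i\<close> off the roots; \<open>b\<close> injective; the edges \<open>{u i, z i}\<close> of one tree
  acyclic; the edges \<open>{u i, z i}\<close> of different trees disjoint.\<close>

definition forbidden :: "nat \<Rightarrow> (nat \<Rightarrow> 'c) \<Rightarrow> 'c set" where
  "forbidden d b =
     (\<lambda>(i, e). a i e) ` ({..<k} \<times> {..<h})
   \<union> (\<lambda>(i, t). c {x i, nb (a i d) (x ((i + t) mod k))}) ` ({..<k} \<times> ({1..<k} - {d + 1}))
   \<union> b ` {..<d}
   \<union> (\<lambda>(i, e). c {x i, nb (a i e) (nb (b e) (x i))}) ` ({..<k} \<times> {..<d})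
   \<union> (\<Union>(j, e)\<in>{..<k} \<times> {..<d}. \<Union>i\<in>{i. i < k \<and> a i d = a j e}.
        {c {x i, nb (b e) (x j)}, c {x i, nb (a j e) (nb (b e) (x j))}})"

lemma forbidden_cong:
  assumes "\<And>e. e < d \<Longrightarrow> f e = g e"
  shows "forbidden d f = forbidden d g"
  unfolding forbidden_def
  by (intro arg_cong2[of _ _ _ _ "(\<union>)"] image_cong SUP_cong) (auto simp: assms)

lemma finite_forbidden: "finite (forbidden d b)"
  unfolding forbidden_def by auto

lemma card_forbidden:
  assumes "d < h"
  shows "card (forbidden d b) < card C"
proof -
  let ?A1 = "(\<lambda>(i, e). a i e) ` ({..<k} \<times> {..<h})"
  let ?A2 = "(\<lambda>(i, t). c {x i, nb (a i d) (x ((i + t) mod k))}) ` ({..<k} \<times> ({1..<k} - {d + 1}))"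
  let ?A3 = "b ` {..<d}"
  let ?A4 = "(\<lambda>(i, e). c {x i, nb (a i e) (nb (b e) (x i))}) ` ({..<k} \<times> {..<d})"
  let ?B = "\<lambda>j e. \<Union>i\<in>{i. i < k \<and> a i d = a j e}.
        {c {x i, nb (b e) (x j)}, c {x i, nb (a j e) (nb (b e) (x j))}}"
  let ?A5 = "\<Union>(j, e)\<in>{..<k} \<times> {..<d}. ?B j e"
  have A1: "card ?A1 \<le> k * h"
    using card_image_le[of "{..<k} \<times> {..<h}" "\<lambda>(i, e). a i e"] by simp
  have "card ?A2 \<le> card ({..<k} \<times> ({1..<k} - {d + 1}))"
    by (rule card_image_le) simp
  also have "\<dots> = k * (2 * h - 1)"
    using assms by (simp add: card_Diff_subset)
  finally have A2: "card ?A2 \<le> k * (2 * h - 1)" .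
  have A3: "card ?A3 \<le> d"
    using card_image_le[of "{..<d}" b] by simp
  have "card ?A4 \<le> card ({..<k} \<times> {..<d})"
    by (rule card_image_le) simp
  then have A4: "card ?A4 \<le> k * d" by simp
  \<comment> \<open>By \<open>class_rainbow\<close> at most one \<open>i\<close> has
    \<open>a i d = a j e\<close>, so the inner union contributes two colours instead of up to
    \<open>2 * k\<close>.\<close>
  have B: "card (?B j e) \<le> 2" for j e
  proof (cases "{i. i < k \<and> a i d = a j e} = {}")
    case False
    then obtain i where i: "i < k" "a i d = a j e" by auto
    have "l = i" if "l < k" "a l d = a j e" for l
      using class_rainbow[of l i d] i that assms by simp
    then have "{i. i < k \<and> a i d = a j e} = {i}"
      using i by blast
    then show ?thesis by (simp add: card_insert_le_m1)
  qed (simp only: UN_empty card.empty zero_le)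
  have "card ?A5 \<le> (\<Sum>(j, e)\<in>{..<k} \<times> {..<d}. card (?B j e))"
    using card_UN_le[of "{..<k} \<times> {..<d}" "\<lambda>(j, e). ?B j e"] by (simp add: case_prod_unfold)
  also have "\<dots> \<le> (\<Sum>(j, e)\<in>{..<k} \<times> {..<d}. 2)"
    using B by (intro sum_mono) auto
  finally have A5: "card ?A5 \<le> 2 * (k * d)" by (simp add: case_prod_unfold)
  have "card (forbidden d b) \<le> card ?A1 + card ?A2 + card ?A3 + card ?A4 + card ?A5"
    unfolding forbidden_def
    by (intro order_trans[OF card_Un_le] add_mono order_refl)
  also have "\<dots> \<le> k * h + k * (2 * h - 1) + d + k * d + 2 * (k * d)"
    using A1 A2 A3 A4 A5 by linarith
  also have "\<dots> < card C"
  proof -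
    \<comment> \<open>With \<open>d <= g = h - 1\<close> the sum is at most
      \<open>12 * h * h - g - 6\<close>, while \<open>card C\<close> is at least
      \<open>12 * h * h - 4\<close>.\<close>
    obtain g where g: "h = Suc g" using assms by (cases h) auto
    then have "d \<le> g" using assms by simp
    then have "k * d \<le> k * g" by (rule mult_le_mono2)
    then have "k * h + k * (2 * h - 1) + d + k * d + 2 * (k * d)
        \<le> k * h + k * (2 * h - 1) + g + 3 * (k * g)"
      using \<open>d \<le> g\<close> by linarith
    moreover have "k * h + k * (2 * h - 1) + g + 3 * (k * g) + g + 6 = 12 * h * h"
      unfolding g by (simp add: algebra_simps)
    ultimately show ?thesis using large card_C g by linarith
  qed
  finally show ?thesis .
qed

text \<open>When \<open>b d\<close> is chosen only the \<open>b e\<close> with \<open>e < d\<close>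
  are known, so the last two conclusions are one-sided. This suffices: the first of them makes links
  inside a tree go to smaller indices, and the other compares two edges from the side of the larger
  index.\<close>

lemma ex_colors:
  obtains b where
    "\<And>d. d < h \<Longrightarrow> b d \<in> C"
    "\<And>d e. d < h \<Longrightarrow> e < h \<Longrightarrow> b d = b e \<Longrightarrow> d = e"
    "\<And>i d. i < k \<Longrightarrow> d < h \<Longrightarrow> nb (b d) (x i) \<notin> x ` {..<k}"
    "\<And>i d. i < k \<Longrightarrow> d < h \<Longrightarrow> nb (a i d) (nb (b d) (x i)) \<notin> x ` {..<k}"
    "\<And>i d e. i < k \<Longrightarrow> d < h \<Longrightarrow> e < d \<Longrightarrow> nb (a i e) (nb (b e) (x i)) \<noteq> nb (b d) (x i)"
    "\<And>i j d e. i < k \<Longrightarrow> j < k \<Longrightarrow> d < h \<Longrightarrow> e < d \<Longrightarrow> a i d = a j e \<Longrightarrow>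
       nb (b d) (x i) \<notin> {nb (b e) (x j), nb (a j e) (nb (b e) (x j))}"
proof -
  have "\<exists>b. \<forall>d<h. b d \<in> C \<and> b d \<notin> forbidden d b"
  proof (rule greedy_choice[where P = "\<lambda>d b y. y \<in> C \<and> y \<notin> forbidden d b"])
    show "\<exists>y. y \<in> C \<and> y \<notin> forbidden d b" if "d < h" for d b
      using ex_notin_small[OF card_forbidden[OF that] finite_forbidden] by blast
  qed (use forbidden_cong in blast)
  then obtain b where C: "\<And>d. d < h \<Longrightarrow> b d \<in> C"
    and b: "\<And>d. d < h \<Longrightarrow> b d \<notin> forbidden d b" by blast
  \<comment> \<open>Apart from injectivity of \<open>b\<close>, each exclusion works through this:
    if \<open>nb (b d) (x i)\<close> were a bad vertex \<open>w\<close>, then \<open>b d\<close>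
    would be the forbidden colour \<open>c {x i, w}\<close>.\<close>
  have u_color: "c {x i, w} = b d" if "i < k" "d < h" "nb (b d) (x i) = w" for i d w
    using nb(3)[OF root_in C] that by blast
  have less: "b e \<noteq> b d" if "d < h" "e < d" for d e
  proof -
    have "b d \<notin> b ` {..<d}" using b[OF that(1)] by (simp add: forbidden_def)
    moreover have "b e \<in> b ` {..<d}" using that(2) by simp
    ultimately show ?thesis by metis
  qed
  have u: "nb (b d) (x i) \<notin> x ` {..<k}" if id: "i < k" "d < h" for i d
  proof
    assume "nb (b d) (x i) \<in> x ` {..<k}"
    then obtain j where j: "j < k" "nb (b d) (x i) = x j" by auto
    then have "j \<noteq> i" using nb(2)[OF root_in C] id by metis
    then have "b d \<in> (\<lambda>(i, e). a i e) ` ({..<k} \<times> {..<h})"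
      using root_pair_color[of i j] u_color[OF id j(2)] id j(1) by simp
    then show False using b[OF id(2)] by (simp add: forbidden_def)
  qed
  have z: "nb (a i d) (nb (b d) (x i)) \<notin> x ` {..<k}" if id: "i < k" "d < h" for i d
  proof
    assume "nb (a i d) (nb (b d) (x i)) \<in> x ` {..<k}"
    then obtain l where l: "l < k" "nb (a i d) (nb (b d) (x i)) = x l" by auto
    have ul: "nb (b d) (x i) = nb (a i d) (x l)"
      using nb_nb[of "nb (b d) (x i)" "a i d"] nb(1)[OF root_in C] a_in id l by metis
    \<comment> \<open>Either equality would make \<open>nb (b d) (x i)\<close> itself a centre,
      \<open>x (step d i)\<close> or \<open>x i\<close>. Hence the cyclic displacement
      \<open>t\<close> from \<open>i\<close> to \<open>l\<close> is neither 0 nor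
      \<open>d + 1\<close>, the two values left out of \<open>forbidden\<close>.\<close>
    then have "l \<noteq> i" "l \<noteq> step d i"
      using nb_a[OF id] nb_a'[OF id] u[OF id] id step_less[of d i] by auto
    define t where "t = (if i < l then l - i else l + k - i)"
    have "i + t = l \<or> i + t = l + k" "t \<in> {1..<k}"
      using id l(1) \<open>l \<noteq> i\<close> by (auto simp: t_def)
    then have t: "(i + t) mod k = l" "t \<in> {1..<k}"
      using l(1) by (metis mod_add_self2 mod_less)+
    moreover have "t \<noteq> d + 1" using t \<open>l \<noteq> step d i\<close> by (auto simp: step_def)
    ultimately have "(i, t) \<in> {..<k} \<times> ({1..<k} - {d + 1})" using id by simp
    from imageI[OF this, of "\<lambda>(i, t). c {x i, nb (a i d) (x ((i + t) mod k))}"]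
    have "c {x i, nb (a i d) (x l)} \<in> forbidden d b"
      using t(1) by (simp add: forbidden_def)
    then show False using b[OF id(2)] u_color[OF id ul] by simp
  qed
  have zu: "nb (a i e) (nb (b e) (x i)) \<noteq> nb (b d) (x i)" if id: "i < k" "d < h" and e: "e < d" for i d e
  proof
    assume eq: "nb (a i e) (nb (b e) (x i)) = nb (b d) (x i)"
    have "(i, e) \<in> {..<k} \<times> {..<d}" using id e by simp
    from imageI[OF this, of "\<lambda>(i, e). c {x i, nb (a i e) (nb (b e) (x i))}"]
    have "c {x i, nb (a i e) (nb (b e) (x i))} \<in> forbidden d b"
      by (simp add: forbidden_def)
    then show False using b[OF id(2)] u_color[OF id eq[symmetric]] by simp
  qed
  have uz: "nb (b d) (x i) \<notin> {nb (b e) (x j), nb (a j e) (nb (b e) (x j))}"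
    if id: "i < k" "d < h" and j: "j < k" and e: "e < d" and eq: "a i d = a j e" for i j d e
  proof
    assume "nb (b d) (x i) \<in> {nb (b e) (x j), nb (a j e) (nb (b e) (x j))}"
    then have "b d \<in> {c {x i, nb (b e) (x j)}, c {x i, nb (a j e) (nb (b e) (x j))}}"
      using u_color[OF id] by force
    moreover have "(j, e) \<in> {..<k} \<times> {..<d}" "i \<in> {i. i < k \<and> a i d = a j e}"
      using id j e eq by auto
    ultimately have "b d \<in> (\<Union>(j, e)\<in>{..<k} \<times> {..<d}. \<Union>i\<in>{i. i < k \<and> a i d = a j e}.
        {c {x i, nb (b e) (x j)}, c {x i, nb (a j e) (nb (b e) (x j))}})"
      by blast
    then show False using b[OF id(2)] unfolding forbidden_def by blast
  qed
  show thesis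
  proof (rule that[of b])
    show "d = e" if "d < h" "e < h" "b d = b e" for d e
      using less[of d e] less[of e d] that by (cases d e rule: linorder_cases) auto
  qed (use C u z zu uz in blast)+
qed

section \<open>The trees and their disjointness\<close>

lemma ex_disjoint_rainbow_trees:
  obtains T where
    "\<And>i. i < k \<Longrightarrow> spanning_tree V (complete_edges V) (T i)"
    "\<And>i. i < k \<Longrightarrow> rainbow c (T i)"
    "\<And>i j. i < k \<Longrightarrow> j < k \<Longrightarrow> i \<noteq> j \<Longrightarrow> T i \<inter> T j = {}"
proof -
  obtain b where C: "\<And>d. d < h \<Longrightarrow> b d \<in> C"
    and b_inj: "\<And>d e. d < h \<Longrightarrow> e < h \<Longrightarrow> b d = b e \<Longrightarrow> d = e"
    and u_root: "\<And>i d. i < k \<Longrightarrow> d < h \<Longrightarrow> nb (b d) (x i) \<notin> x ` {..<k}"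
    and z_root: "\<And>i d. i < k \<Longrightarrow> d < h \<Longrightarrow> nb (a i d) (nb (b d) (x i)) \<notin> x ` {..<k}"
    and zu: "\<And>i d e. i < k \<Longrightarrow> d < h \<Longrightarrow> e < d \<Longrightarrow> nb (a i e) (nb (b e) (x i)) \<noteq> nb (b d) (x i)"
    and uz: "\<And>i j d e. i < k \<Longrightarrow> j < k \<Longrightarrow> d < h \<Longrightarrow> e < d \<Longrightarrow> a i d = a j e \<Longrightarrow>
       nb (b d) (x i) \<notin> {nb (b e) (x j), nb (a j e) (nb (b e) (x j))}"
    using ex_colors by blast
  define u where "u i d = nb (b d) (x i)" for i d
  define z where "z i d = nb (a i d) (u i d)" for i d
  have u: "u i d \<in> V" "u i d \<noteq> x i" "c {x i, u i d} = b d" if "i < k" "d < h" for i d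
    using nb[OF root_in C] that by (auto simp: u_def)
  have z: "z i d \<in> V" "z i d \<noteq> u i d" "c {u i d, z i d} = a i d" if "i < k" "d < h" for i d
    using nb[OF u(1) a_in] that by (auto simp: z_def)
  have u_neq: "u i d \<noteq> x j" and z_neq: "z i d \<noteq> x j" if "i < k" "d < h" "j < k" for i j d
    using u_root[of i d] z_root[of i d] that by (auto simp: u_def z_def)
  have u_inj: "d = e" if "i < k" "d < h" "e < h" "u i d = u i e" for i d e
    using u(3)[of i d] u(3)[of i e] b_inj that by simp
  have z_eq_u: "e < d" if "i < k" "d < h" "e < h" "z i d = u i e" for i d e
    using zu[of i e d] z(2)[of i d] that
    by (cases d e rule: linorder_cases) (auto simp: u_def z_def)
  \<comment> \<open>\<open>S i\<close> and \<open>U i\<close> are the leaves of the star at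
    \<open>x i\<close> that get reattached; \<open>par i\<close> sends them to their new neighbours
    and every other leaf to \<open>x i\<close>.\<close>
  define S where "S i = (\<lambda>d. x (step d i)) ` {..<h}" for i
  define U where "U i = u i ` {..<h}" for i
  define par where "par i v =
    (if v \<in> S i then let d = inv_into {..<h} (\<lambda>d. x (step d i)) v in u (step d i) d
     else if v \<in> U i then z i (inv_into {..<h} (u i) v) else x i)" for i v
  have inj_S: "inj_on (\<lambda>d. x (step d i)) {..<h}" if "i < k" for i
  proof (rule inj_onI)
    fix d e assume "d \<in> {..<h}" "e \<in> {..<h}" "x (step d i) = x (step e i)"
    then show "d = e"
      using root_eq_iff[OF step_less[of d i] step_less[of e i]] step_inj_distance[OF that, of d e]
      by simp
  qed
  have inj_U: "inj_on (u i) {..<h}" if "i < k" for i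
    using that u_inj by (intro inj_onI) auto
  have par_S: "par i (x (step d i)) = u (step d i) d" if "i < k" "d < h" for i d
    using inv_into_f_f[OF inj_S[OF that(1)], of d] that by (auto simp: par_def S_def Let_def)
  have U_notin_S: "u i d \<notin> S i" if "i < k" "d < h" for i d
    using u_neq[OF that] step_less by (auto simp: S_def)
  have par_U: "par i (u i d) = z i d" if "i < k" "d < h" for i d
    using inv_into_f_f[OF inj_U[OF that(1)], of d] that U_notin_S[OF that]
    by (auto simp: par_def U_def)
  have par_else: "par i v = x i" if "v \<notin> S i" "v \<notin> U i" for i v
    using that by (simp add: par_def)
  define T where "T i = (\<lambda>v. {v, par i v}) ` (V - {x i})" for i

  have cases_v: thesis
    if "\<And>d. d < h \<Longrightarrow> v = x (step d i) \<Longrightarrow> thesis" "\<And>d. d < h \<Longrightarrow> v = u i d \<Longrightarrow> thesis"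
      "v \<notin> S i \<Longrightarrow> v \<notin> U i \<Longrightarrow> thesis" for i v thesis
    using that by (auto simp: S_def U_def)

  have tree: "spanning_tree V (complete_edges V) (T i)" if i: "i < k" for i
  proof -
    \<comment> \<open>The value \<open>d + 2\<close> works for \<open>u i d\<close> because
      \<open>z i d\<close> equals \<open>u i e\<close> only if \<open>e < d\<close>, and otherwise
      has rank 1. Vertices of \<open>S i\<close> come on top: their parents are off the centres, so
      have rank at most \<open>h + 1\<close>.\<close>
    define rank where "rank v =
      (if v = x i then 0 else if v \<in> S i then h + 2
       else if v \<in> U i then inv_into {..<h} (u i) v + 2 else 1)" for v
    have rank_U: "rank (u i d) = d + 2" if "d < h" for d
      using inv_into_f_f[OF inj_U[OF i], of d] that U_notin_S[OF i that] u(2)[OF i that]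
      by (auto simp: rank_def U_def)
    have rank_S: "rank (x (step d i)) = h + 2" if "d < h" for d
      using root_step_neq[OF i that] that by (auto simp: rank_def S_def)
    have rank_le: "rank v \<le> h + 1" if "v \<notin> S i" for v
    proof (cases "v \<in> U i")
      case True
      then show ?thesis using rank_U by (auto simp: U_def)
    qed (use that in \<open>auto simp: rank_def\<close>)
    have "par i v \<in> V \<and> rank (par i v) < rank v" if v: "v \<in> V - {x i}" for v
    proof (rule cases_v[of v i])
      fix d assume d: "d < h" "v = x (step d i)"
      have "u (step d i) d \<notin> S i"
        using u_neq[OF step_less d(1)] step_less by (auto simp: S_def)
      then show ?thesis
        using d par_S[OF i] rank_S rank_le[of "u (step d i) d"] u(1)[OF step_less d(1)] by auto
    next
      fix d assume d: "d < h" "v = u i d"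
      have zS: "z i d \<notin> S i" using z_neq[OF i d(1)] step_less by (auto simp: S_def)
      have "rank (z i d) < d + 2"
      proof (cases "z i d \<in> U i")
        case True
        then obtain e where "e < h" "z i d = u i e" by (auto simp: U_def)
        then show ?thesis using z_eq_u[OF i d(1)] rank_U by auto
      qed (use zS in \<open>auto simp: rank_def\<close>)
      then show ?thesis using d par_U[OF i] rank_U z(1)[OF i] by auto
    next
      assume "v \<notin> S i" "v \<notin> U i"
      then show ?thesis using par_else root_in[OF i] v by (auto simp: rank_def)
    qed
    then show ?thesis
      unfolding T_def using spanning_tree_of_parents[of "x i" V "par i" rank] root_in[OF i] by blast
  qed

  have S_V: "v \<in> V - {x i}" if "i < k" "v \<in> S i" for i v
    using that root_in[OF step_less] root_step_neq by (auto simp: S_def)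

  have rainbow: "rainbow c (T i)" if i: "i < k" for i
  proof -
    \<comment> \<open>\<open>T i\<close> has at most \<open>card C\<close> edges, so showing every
      colour is enough for injectivity. If the star edge of colour \<open>q\<close> was given up,
      one of the two replacement edges carries \<open>q\<close>.\<close>
    have "C \<subseteq> c ` T i"
    proof
      fix q assume q: "q \<in> C"
      define w where "w = nb q (x i)"
      have w: "w \<in> V - {x i}" "c {x i, w} = q" using nb[OF root_in[OF i] q] by (auto simp: w_def)
      show "q \<in> c ` T i"
      proof (rule cases_v[of w i])
        fix d assume d: "d < h" "w = x (step d i)"
        then have "q = c {u i d, par i (u i d)}"
          using w(2) z(3)[OF i] par_U[OF i] by (simp add: arc_color_def)
        moreover have "u i d \<in> V - {x i}" using u[OF i d(1)] by simp
        ultimately show ?thesis unfolding T_def by blast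
      next
        fix d assume d: "d < h" "w = u i d"
        then have "q = c {x (step d i), par i (x (step d i))}"
          using w(2) u(3)[OF i] u(3)[OF step_less] par_S[OF i] by simp
        moreover have "x (step d i) \<in> V - {x i}" using S_V[OF i] d(1) by (auto simp: S_def)
        ultimately show ?thesis unfolding T_def by blast
      next
        assume "w \<notin> S i" "w \<notin> U i"
        then have "q = c {w, par i w}" using w(2) par_else by (simp add: insert_commute)
        then show ?thesis unfolding T_def using w(1) by blast
      qed
    qed
    have fin: "finite (T i)" using finite_V by (simp add: T_def)
    have "card (T i) \<le> card (V - {x i})"
      unfolding T_def using finite_V by (intro card_image_le) simp
    also have "\<dots> = card C" using card_C finite_V root_in[OF i] by simp
    also have "\<dots> \<le> card (c ` T i)"
      using \<open>C \<subseteq> c ` T i\<close> fin by (intro card_mono) auto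
    finally have "card (c ` T i) = card (T i)"
      using card_image_le[OF fin, of c] by simp
    then show ?thesis unfolding rainbow_def by (rule eq_card_imp_inj_on[OF fin])
  qed

  have cases_T: thesis
    if i: "i < k" and f: "f \<in> T i" and
      "\<And>d. d < h \<Longrightarrow> f = {x (step d i), u (step d i) d} \<Longrightarrow> thesis"
      "\<And>d. d < h \<Longrightarrow> f = {u i d, z i d} \<Longrightarrow> thesis"
      "\<And>v. v \<noteq> x i \<Longrightarrow> v \<notin> S i \<Longrightarrow> v \<notin> U i \<Longrightarrow> f = {x i, v} \<Longrightarrow> thesis" for i f thesis
  proof -
    obtain v where v: "v \<in> V - {x i}" "f = {v, par i v}"
      using f by (auto simp: T_def)
    show thesis
      by (rule cases_v[of v i]) (use v par_S par_U par_else that in \<open>auto simp: insert_commute\<close>)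
  qed

  \<comment> \<open>Equal edges have equal colours, so \<open>a i d = a j e\<close>, and
    \<open>u i d\<close> is an end of the other edge, against \<open>uz\<close>.\<close>
  have zz: False if "i < k" "j < k" "d < h" "e < d" "{u i d, z i d} = {u j e, z j e}" for i j d e
  proof -
    have "a i d = a j e" using z(3)[of i d] z(3)[of j e] that by simp
    from uz[OF that(1-4) this] show False using that(5) by (auto simp: u_def z_def doubleton_eq_iff)
  qed
  \<comment> \<open>The common edge could only be \<open>{x i, x j}\<close>, which the tree at the
    tail of the arc has given up.\<close>
  have star_star: False
    if ij: "i < k" "j < k" "i \<noteq> j" and vS: "v \<notin> S i" and wS: "w \<notin> S j"
      and eq: "{x i, v} = {x j, w}" for i j v w
  proof -
    have "x i \<noteq> x j" using ij by (simp add: root_eq_iff)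
    then have vw: "v = x j" "w = x i" using eq by (auto simp: doubleton_eq_iff)
    obtain d where "d < h" "j = step d i \<or> i = step d j" using step_total[OF ij] by blast
    then have "v \<in> S i \<or> w \<in> S j" unfolding vw S_def by blast
    then show False using vS wS by blast
  qed
  \<comment> \<open>The centre on the link must be \<open>x i\<close>, so the link is
    \<open>{x i, u i d}\<close>, which the \<open>i\<close>-th tree has given up.\<close>
  have star_link: False
    if "i < k" "j < k" "d < h" "v \<notin> U i" "{x i, v} = {x (step d j), u (step d j) d}" for i j d v
  proof -
    have "x i = x (step d j)" "v = u (step d j) d"
      using that(5) u_neq[OF step_less[of d j] that(3) that(1)] by (auto simp: doubleton_eq_iff)
    then have "v = u i d" using root_eq_iff[OF that(1) step_less] by simp
    then show False using that(3,4) by (simp add: U_def)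
  qed
  have off_roots: "f \<inter> x ` {..<k} = {}" if "i < k" "d < h" "f = {u i d, z i d}" for i d f
    using u_neq z_neq that by auto
  have "T i \<inter> T j = {}" if ij: "i < k" "j < k" "i \<noteq> j" for i j
  proof (rule ccontr)
    assume "T i \<inter> T j \<noteq> {}"
    then obtain f where f: "f \<in> T i" "f \<in> T j" by auto
    have on_root: "f \<inter> x ` {..<k} \<noteq> {}" if "l < k" "f = {x l, v}" for l v
      using that by auto
    show False
    proof (rule cases_T[OF ij(1) f(1)])
      fix d assume d: "d < h" "f = {x (step d i), u (step d i) d}"
      show False
      proof (rule cases_T[OF ij(2) f(2)])
        fix e assume e: "e < h" "f = {x (step e j), u (step e j) e}"
        \<comment> \<open>No \<open>u\<close> is a centre, so the centres of the two links agree and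
          then so do their other ends. Injectivity of \<open>b\<close> gives \<open>d = e\<close>,
          and that of \<open>step d\<close> gives \<open>i = j\<close>.\<close>
        have "x (step d i) = x (step e j)" and u_eq: "u (step d i) d = u (step e j) e"
          using d(2) e(2) u_neq[OF step_less[of e j] e(1) step_less[of d i]]
          by (auto simp: doubleton_eq_iff)
        then have "step d i = step e j" using root_eq_iff[OF step_less step_less] by blast
        then have "d = e" using u_inj[OF step_less d(1) e(1)] u_eq by metis
        then show False using \<open>step d i = step e j\<close> step_inj ij d(1) by blast
      next
        fix e assume "e < h" "f = {u j e, z j e}"
        then show False using off_roots[OF ij(2)] on_root[OF step_less d(2)] by blast
      next
        fix v assume "v \<notin> U j" "f = {x j, v}"
        then show False using star_link[OF ij(2) ij(1) d(1)] d(2) by blast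
      qed
    next
      fix d assume d: "d < h" "f = {u i d, z i d}"
      note off = off_roots[OF ij(1) d]
      show False
      proof (rule cases_T[OF ij(2) f(2)])
        fix e assume "e < h" "f = {x (step e j), u (step e j) e}"
        then show False using off on_root[OF step_less] by blast
      next
        fix e assume e: "e < h" "f = {u j e, z j e}"
        show False
        proof (cases d e rule: linorder_cases)
          case less
          then show False using zz[OF ij(2) ij(1) e(1) less] d e by simp
        next
          case equal
          then have "a i d = a j d" using z(3)[OF ij(1) d(1)] z(3)[OF ij(2) e(1)] d e by simp
          then show False using class_rainbow ij d(1) by blast
        next
          case greater
          then show False using zz[OF ij(1) ij(2) d(1) greater] d e by simp
        qed
      next
        fix v assume "f = {x j, v}"
        then show False using off on_root[OF ij(2)] by blast
      qed
    next
      fix v assume v: "v \<notin> S i" "v \<notin> U i" "f = {x i, v}"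
      show False
      proof (rule cases_T[OF ij(2) f(2)])
        fix e assume "e < h" "f = {x (step e j), u (step e j) e}"
        then show False using star_link[OF ij(1) ij(2) _ v(2)] v(3) by blast
      next
        fix e assume "e < h" "f = {u j e, z j e}"
        then show False using off_roots[OF ij(2)] on_root[OF ij(1) v(3)] by blast
      next
        fix w assume "w \<notin> S j" "f = {x j, w}"
        then show False using star_star[OF ij v(1)] v(3) by blast
      qed
    qed
  qed
  then show thesis using that tree rainbow by blast
qed

end

section \<open>Numerical bound and counting\<close>

theorem theorem2p1:
  fixes m :: nat and V :: "'a set" and C :: "'c set" and c :: "'a set \<Rightarrow> 'c"
  assumes "m \<ge> 1"
    and "finite V" and "card V = 2 * m"
    and "finite C" and "card C = 2 * m - 1"
    and "proper_edge_coloring (complete_edges V) C c"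
  shows "\<exists>\<T>. finite \<T>
           \<and> int (card \<T>) \<ge> \<lfloor>sqrt (6 * real m + 9) / 3\<rfloor>
           \<and> (\<forall>T\<in>\<T>. spanning_tree V (complete_edges V) T \<and> rainbow c T)
           \<and> pairwise disjnt \<T>"
proof -
  define n where "n = nat \<lfloor>sqrt (6 * real m + 9) / 3\<rfloor>"
  \<comment> \<open>Then \<open>k = 2 * h + 1\<close> is \<open>n\<close> or \<open>n + 1\<close>,
    while \<open>2 * h <= n\<close> bounds \<open>12 * h * h\<close> by \<open>3 * n * n\<close>.
    Squaring the definition of \<open>n\<close> gives \<open>3 * n * n <= 2 * m + 3\<close>, hence
    \<open>large\<close>.\<close>
  define h where "h = n div 2"
  have n: "\<lfloor>sqrt (6 * real m + 9) / 3\<rfloor> = int n" by (simp add: n_def)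
  then have "real n \<le> sqrt (6 * real m + 9) / 3" by linarith
  then have "(3 * real n)\<^sup>2 \<le> (sqrt (6 * real m + 9))\<^sup>2"
    by (intro power_mono) auto
  then have "(3 * real n)\<^sup>2 \<le> 6 * real m + 9" by simp
  then have "real (9 * (n * n)) \<le> real (6 * m + 9)"
    by (simp add: power2_eq_square)
  then have "3 * (n * n) \<le> 2 * m + 3" by linarith
  moreover have "(2 * h) * (2 * h) \<le> n * n"
    by (intro mult_mono) (auto simp: h_def)
  moreover have "12 * h * h = 3 * ((2 * h) * (2 * h))" by simp
  ultimately have large: "12 * h * h \<le> card V + 3" using assms(3) by linarith
  interpret rooted_one_factorization V C c h
    using assms large by unfold_locales auto
  obtain x where x: "inj_on x {..<Suc (2 * h)}" "x ` {..<Suc (2 * h)} \<subseteq> V"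
    "\<And>i j d. i < Suc (2 * h) \<Longrightarrow> j < Suc (2 * h) \<Longrightarrow> d < h \<Longrightarrow> arc_color x i d = arc_color x j d \<Longrightarrow> i = j"
    using ex_roots by blast
  interpret rainbow_roots V C c h x
    using x by unfold_locales
  obtain T where T: "\<And>i. i < k \<Longrightarrow> spanning_tree V (complete_edges V) (T i)"
    "\<And>i. i < k \<Longrightarrow> rainbow c (T i)"
    "\<And>i j. i < k \<Longrightarrow> j < k \<Longrightarrow> i \<noteq> j \<Longrightarrow> T i \<inter> T j = {}"
    using ex_disjoint_rainbow_trees by blast
  \<comment> \<open>Disjoint edge sets could coincide if both were empty; nonemptiness makes
    \<open>T\<close> injective, so the set of trees really has \<open>k\<close> members.\<close>
  have nonempty: "T i \<noteq> {}" if i: "i < k" for i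
  proof
    assume empty: "T i = {}"
    have "\<not> card V \<le> 1" using assms(1,3) by simp
    then obtain v w where vw: "v \<in> V" "w \<in> V" "v \<noteq> w"
      using card_le_Suc0_iff_eq[OF \<open>finite V\<close>] by auto
    then obtain p where p: "walk_in (T i) p" "hd p = v" "last p = w"
      using T(1)[OF i] unfolding spanning_tree_def connected_graph_def by blast
    then have "p = [v]"
      using empty by (cases p) (auto simp: walk_in_def successively_Cons)
    then show False using p vw by simp
  qed
  have "inj_on T {..<k}"
    using T(3) nonempty by (intro inj_onI) force
  then have "card (T ` {..<k}) = k" by (simp add: card_image)
  moreover have "n \<le> k" by (simp add: h_def)
  moreover have "pairwise disjnt (T ` {..<k})"
    using T(3) by (auto simp: pairwise_def disjnt_def)
  ultimately show ?thesis
    using T(1,2) n by (intro exI[of _ "T ` {..<k}"]) auto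
qed

end
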